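(* The optimization problem RBOPF is a relaxation of the optimization problem BOPF (both defined in the context, for the same network data). That is, if $(s,\mathfrak{s},v,i,i',r,A)$ is any feasible point of BOPF, then the point $(s,\mathfrak{s},V,I,S,S',r,A)$ given by the correspondence between the variables of the two problems, $V_m=v_m\bar v_m$ ($m\in\mathcal N$), $I_{nm}=i_{nm}\bar i_{nm}$ and $S_{nm}=v_n\bar i_{nm}$ ($(n,m)\in\mathcal E$), $S'_{nm}=v_m\bar i'_{nm}$ ($(n,m)\in\mathcal E_{\mathrm r}$), is feasible for RBOPF, with the same objective value.
   Context: **Notation.** $\bar{x}$ denotes the conjugate transpose of a vector or matrix $x$, and $x^*$ the entrywise complex conjugate. For a vector $x$, $\mathrm{diag}(x)$ is the diagonal matrix with diagonal $x$; for a square matrix $X$, $\mathrm{diag}(X)$ is the vector of its diagonal entries. Inequalities and absolute values of vectors are entrywise. $\mathbf O$ is a zero matrix, $\succeq$ is the positive semidefinite order on Hermitian matrices. Vectors in $\mathbb C^3$ are indexed by the phases $\Omega=\{a,b,c\}$. **Network.** $(\mathcal N,\mathcal E)$ is a finite directed graph, $\mathcal N=\{0,1,\dots,N\}$, $\mathcal E\subseteq\mathcal N\times\mathcal N$; write $n\to m$ for $(n,m)\in\mathcal E$. $\mathcal E=\mathcal E_{\mathrm t}\cup\mathcal E_{\mathrm r}$ is a partition into lines/transformers ($\mathcal E_{\mathrm t}$) and step-voltage regulators (SVRs, $\mathcal E_{\mathrm r}$). For $m\in\mathcal N$ let $\mathcal N_m^{\mathrm p}=\{n:(n,m)\in\mathcal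 E_{\mathrm r}\}$. Given data: $Z_{nm}\in\mathbb C^{3\times3}$ for $(n,m)\in\mathcal E_{\mathrm t}$; $Y_m\in\mathbb C^{3\times 3}$ for $m\in\mathcal N$; $\mathrm v_0\in\mathbb C^3$; real $0<v_{\min}\le v_{\max}$; a set $\mathcal S$ of allowed vectors $\mathfrak s=\{\mathfrak s_m\}_{m\in\mathcal N}$, $\mathfrak s_m\in\mathbb C^3$. **SVR types.** Each $(n,m)\in\mathcal E_{\mathrm r}$ has one of three types (wye, closed-delta, open-delta), with real turns ratios $r_{nm}=(r^a_{nm},r^b_{nm},r^c_{nm})$ and a gain matrix $A_{nm}$. **BOPF.** Variables: $s=\{s_m\},\mathfrak s=\{\mathfrak s_m\},v=\{v_m\}$ ($m\in\mathcal N$), $i=\{i_{nm}\}_{\mathcal E}$, $i'=\{i'_{nm}\}_{\mathcal E_{\mathrm r}}$ (all entries in $\mathbb C^3$), $r=\{r_{nm}\}_{\mathcal E_{\mathrm r}}$, $A=\{A_{nm}\}_{\mathcal E_{\mathrm r}}$. Minimize $c(s_0,\mathfrak s,v,i)$ subject to: (B1) $v_m=v_n-Z_{nm}i_{nm}$ for $(n,m)\in\mathcal E_{\mathrm t}$; (B2) $v_n=A_{nm}v_m$ and $i_{nm}=\bar A_{nm}^{-1}i'_{nm}$ for $(n,m)\in\mathcal E_{\mathrm r}$; (B3) for $(n,m)\in\mathcal E_{\mathrm r}$, $0.9\le r_{nm}\le1.1$ entrywise (with $r_{nm}^b=1$ fixed for open-delta), and $A_{nm}$ is determined by $r_{nm}$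 according to the type of $(n,m)$ (subscripts $nm$ suppressed in the matrices): wye: $A_{nm}=\mathrm{diag}(r_{nm})$; closed-delta: $A_{nm}=\begin{bmatrix} r^a&1-r^a&0\\0&r^b&1-r^b\\1-r^c&0&r^c\end{bmatrix}$; open-delta: $A_{nm}=\begin{bmatrix} r^a&1-r^a&0\\0&1&0\\0&1-r^c&r^c\end{bmatrix}$; (B4) $s_m=\mathfrak s_m-\mathrm{diag}(v_m\bar v_m\bar Y_m)$, $m\in\mathcal N$; (B5) $s_m=\sum_{k:m\to k}\mathrm{diag}(v_m\bar i_{mk})-\sum_{n:n\to m,\,n\in\mathcal N_m^{\mathrm p}}\mathrm{diag}(v_m\bar i'_{nm})-\sum_{n:n\to m,\,n\notin\mathcal N_m^{\mathrm p}}\mathrm{diag}(v_m\bar i_{nm})$, $m\in\mathcal N$; (B6) $v_0=\mathrm v_0$; $v_{\min}\le|v_n|\le v_{\max}$ for $n\in\mathcal N$; $\mathfrak s\in\mathcal S$. **RBOPF.** Variables: $s=\{s_m\}_{\mathcal N}$, $\mathfrak s=\{\mathfrak s_m\}_{\mathcal N}$ (entries in $\mathbb C^3$), $r=\{r_{nm}\}_{\mathcal E_{\mathrm r}}$, $A=\{A_{nm}\}_{\mathcal E_{\mathrm r}}$, and complex $3\times3$ matrices $V=\{V_m\}_{\mathcal N}$, $I=\{I_{nm}\}_{\mathcal E}$, $S=\{S_{nm}\}_{\mathcal E}$, $S'=\{S'_{nm}\}_{\mathcal E_{\mathrm r}}$. Minimize $c(s_0,\mathfrak s,V,I)$ subject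 to (B3), $\mathfrak s\in\mathcal S$, and: (R1) $V_m=V_n+Z_{nm}I_{nm}\bar Z_{nm}-(S_{nm}\bar Z_{nm}+Z_{nm}\bar S_{nm})$, $(n,m)\in\mathcal E_{\mathrm t}$; (R2) $V_n=A_{nm}V_m\bar A_{nm}$, $(n,m)\in\mathcal E_{\mathrm r}$; (R3) $\mathrm{diag}(A_{nm}^{-1}S_{nm}A_{nm})=\mathrm{diag}(S'_{nm})$, $(n,m)\in\mathcal E_{\mathrm r}$; (R4) $s_m=\mathfrak s_m-\mathrm{diag}(V_m\bar Y_m)$, $m\in\mathcal N$; (R5) $s_m=\sum_{k:m\to k}\mathrm{diag}(S_{mk})-\sum_{n:n\to m,\,n\in\mathcal N_m^{\mathrm p}}\mathrm{diag}(S'_{nm})-\sum_{n:n\to m,\,n\notin\mathcal N_m^{\mathrm p}}\mathrm{diag}(S_{nm}-Z_{nm}I_{nm})$, $m\in\mathcal N$; (R6) $V_0=\mathrm v_0\bar{\mathrm v}_0$; $v_{\min}^2\le\mathrm{diag}(V_n)\le v_{\max}^2$, $n\in\mathcal N$; (R7) $\begin{bmatrix}V_n&S_{nm}\\\bar S_{nm}&I_{nm}\end{bmatrix}\succeq\mathbf O$ and this matrix has rank $1$, $(n,m)\in\mathcal E$. **Cost convention.** The cost of BOPF depends on $(v,i)$ only through $V_m=v_m\bar v_m$ and $I_{nm}=i_{nm}\bar i_{nm}$; $c(s_0,\mathfrak s,V,I)$ denotes the same cost written in these variables. *)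

theory Defs
  imports "HOL-Analysis.Analysis" "HOL-Library.FuncSet"
begin

text \<open>The phases \<open>a\<close>, \<open>b\<close>, \<open>c\<close> are the indices \<open>1\<close>, \<open>2\<close>, \<open>3\<close> of type \<open>3\<close>.\<close>

type_synonym cvec = "complex^3"
type_synonym cmat = "complex^3^3"
type_synonym edge = "nat \<times> nat"

subsection \<open>Matrices\<close>

definition ctrans :: "complex^'n^'m \<Rightarrow> complex^'m^'n" where
  "ctrans M = (\<chi> p q. cnj (M $ q $ p))"

text \<open>\<open>outer x y\<close> is the product of the column \<open>x\<close> and the conjugate transpose of the column \<open>y\<close>.\<close>

definition outer :: "complex^'m \<Rightarrow> complex^'n \<Rightarrow> complex^'n^'m" where
  "outer x y = (\<chi> p q. x $ p * cnj (y $ q))"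

definition diag_of :: "'a^'n^'n \<Rightarrow> 'a^'n" where
  "diag_of M = (\<chi> p. M $ p $ p)"

definition diag_mat :: "'a::zero^'n \<Rightarrow> 'a^'n^'n" where
  "diag_mat x = (\<chi> p q. if p = q then x $ p else 0)"

definition complex_mat :: "real^'n^'m \<Rightarrow> complex^'n^'m" where
  "complex_mat M = (\<chi> p q. complex_of_real (M $ p $ q))"

definition block_mat ::
    "'a^'n^'m \<Rightarrow> 'a^'k^'m \<Rightarrow> 'a^'n^'l \<Rightarrow> 'a^'k^'l \<Rightarrow> 'a^('n + 'k)^('m + 'l)" where
  "block_mat P Q R T = (\<chi> p q.
     case p of
       Inl i \<Rightarrow> (case q of Inl j \<Rightarrow> P $ i $ j | Inr j \<Rightarrow> Q $ i $ j)
     | Inr i \<Rightarrow> (case q of Inl j \<Rightarrow> R $ i $ j | Inr j \<Rightarrow> T $ i $ j))"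

text \<open>For a Hermitian \<open>M\<close> the quadratic form below is real, so \<open>Re\<close> discards nothing.\<close>

definition psd :: "complex^'n^'n \<Rightarrow> bool" where
  "psd M \<longleftrightarrow> ctrans M = M \<and>
     (\<forall>x. 0 \<le> Re (\<Sum>p\<in>UNIV. \<Sum>q\<in>UNIV. cnj (x $ p) * M $ p $ q * x $ q))"

subsection \<open>Network data\<close>

datatype svr_type = Wye | Closed_Delta | Open_Delta

text \<open>The nodes are \<open>0, \<dots>, last_node\<close>. Only the values of \<open>Zmat\<close>, \<open>Ymat\<close> and \<open>svr\<close> on
  \<open>Et\<close>, on the nodes and on \<open>Er\<close>, respectively, are ever used.\<close>

record network =
  last_node :: nat
  Et :: "edge set"
  Er :: "edge set"
  Zmat :: "edge \<Rightarrow> cmat"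
  Ymat :: "nat \<Rightarrow> cmat"
  vref :: cvec
  vmin :: real
  vmax :: real
  inj_set :: "(nat \<Rightarrow> cvec) set"
  svr :: "edge \<Rightarrow> svr_type"

definition nodes :: "network \<Rightarrow> nat set" where
  "nodes net = {0..last_node net}"

definition edges :: "network \<Rightarrow> edge set" where
  "edges net = Et net \<union> Er net"

definition svr_parents :: "network \<Rightarrow> nat \<Rightarrow> nat set" where
  "svr_parents net m = {n. (n, m) \<in> Er net}"

text \<open>A family indexed by a set \<open>J\<close> is an element of \<open>J \<rightarrow>\<^sub>E UNIV\<close>, here and below.\<close>

definition valid_network :: "network \<Rightarrow> bool" where
  "valid_network net \<longleftrightarrow>
     edges net \<subseteq> nodes net \<times> nodes net \<and>
     Et net \<inter> Er net = {} \<and>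
     0 < vmin net \<and> vmin net \<le> vmax net \<and>
     inj_set net \<subseteq> (nodes net \<rightarrow>\<^sub>E UNIV)"

subsection \<open>Regulator constraints, common to both problems\<close>

fun gain_matrix :: "svr_type \<Rightarrow> real^3 \<Rightarrow> cmat" where
  "gain_matrix Wye r = complex_mat (diag_mat r)"
| "gain_matrix Closed_Delta r = complex_mat (vector
     [vector [r $ 1,     1 - r $ 1, 0        ],
      vector [0,         r $ 2,     1 - r $ 2],
      vector [1 - r $ 3, 0,         r $ 3    ]])"
| "gain_matrix Open_Delta r = complex_mat (vector
     [vector [r $ 1, 1 - r $ 1, 0    ],
      vector [0,     1,         0    ],
      vector [0,     1 - r $ 3, r $ 3]])"

definition svr_constraints :: "network \<Rightarrow> (edge \<Rightarrow> real^3) \<Rightarrow> (edge \<Rightarrow> cmat) \<Rightarrow> bool" where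
  "svr_constraints net r A \<longleftrightarrow> (\<forall>e\<in>Er net.
     (\<forall>p. 0.9 \<le> r e $ p \<and> r e $ p \<le> 1.1) \<and>
     (svr net e = Open_Delta \<longrightarrow> r e $ 2 = 1) \<and>
     A e = gain_matrix (svr net e) (r e))"

subsection \<open>The problem BOPF\<close>

record bopf_point =
  bs :: "nat \<Rightarrow> cvec"
  binj :: "nat \<Rightarrow> cvec"
  bv :: "nat \<Rightarrow> cvec"
  bi :: "edge \<Rightarrow> cvec"
  bi' :: "edge \<Rightarrow> cvec"
  br :: "edge \<Rightarrow> real^3"
  bA :: "edge \<Rightarrow> cmat"

definition bopf_domain :: "network \<Rightarrow> bopf_point set" where
  "bopf_domain net = {x.
     bs x \<in> nodes net \<rightarrow>\<^sub>E UNIV \<and> binj x \<in> nodes net \<rightarrow>\<^sub>E UNIV \<and>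
     bv x \<in> nodes net \<rightarrow>\<^sub>E UNIV \<and> bi x \<in> edges net \<rightarrow>\<^sub>E UNIV \<and>
     bi' x \<in> Er net \<rightarrow>\<^sub>E UNIV \<and> br x \<in> Er net \<rightarrow>\<^sub>E UNIV \<and> bA x \<in> Er net \<rightarrow>\<^sub>E UNIV}"

definition bopf_feasible :: "network \<Rightarrow> bopf_point set" where
  "bopf_feasible net = {x \<in> bopf_domain net.
     (\<forall>(n, m)\<in>Et net. bv x m = bv x n - Zmat net (n, m) *v bi x (n, m)) \<and>
     (\<forall>(n, m)\<in>Er net.
        bv x n = bA x (n, m) *v bv x m \<and>
        bi x (n, m) = matrix_inv (ctrans (bA x (n, m))) *v bi' x (n, m)) \<and>
     svr_constraints net (br x) (bA x) \<and>
     (\<forall>m\<in>nodes net.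
        bs x m = binj x m - diag_of (outer (bv x m) (bv x m) ** ctrans (Ymat net m))) \<and>
     (\<forall>m\<in>nodes net.
        bs x m =
          (\<Sum>k\<in>{k. (m, k) \<in> edges net}. diag_of (outer (bv x m) (bi x (m, k))))
        - (\<Sum>n\<in>{n. (n, m) \<in> edges net \<and> n \<in> svr_parents net m}.
             diag_of (outer (bv x m) (bi' x (n, m))))
        - (\<Sum>n\<in>{n. (n, m) \<in> edges net \<and> n \<notin> svr_parents net m}.
             diag_of (outer (bv x m) (bi x (n, m))))) \<and>
     bv x 0 = vref net \<and>
     (\<forall>n\<in>nodes net. \<forall>p. vmin net \<le> cmod (bv x n $ p) \<and> cmod (bv x n $ p) \<le> vmax net) \<and>
     binj x \<in> inj_set net}"

type_synonym bopf_cost =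
  "cvec \<Rightarrow> (nat \<Rightarrow> cvec) \<Rightarrow> (nat \<Rightarrow> cvec) \<Rightarrow> (edge \<Rightarrow> cvec) \<Rightarrow> real"

definition bopf_objective :: "bopf_cost \<Rightarrow> bopf_point \<Rightarrow> real" where
  "bopf_objective c x = c (bs x 0) (binj x) (bv x) (bi x)"

subsection \<open>The problem RBOPF\<close>

record rbopf_point =
  rs :: "nat \<Rightarrow> cvec"
  rinj :: "nat \<Rightarrow> cvec"
  rV :: "nat \<Rightarrow> cmat"
  rI :: "edge \<Rightarrow> cmat"
  rS :: "edge \<Rightarrow> cmat"
  rS' :: "edge \<Rightarrow> cmat"
  rr :: "edge \<Rightarrow> real^3"
  rA :: "edge \<Rightarrow> cmat"

definition rbopf_domain :: "network \<Rightarrow> rbopf_point set" where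
  "rbopf_domain net = {y.
     rs y \<in> nodes net \<rightarrow>\<^sub>E UNIV \<and> rinj y \<in> nodes net \<rightarrow>\<^sub>E UNIV \<and>
     rV y \<in> nodes net \<rightarrow>\<^sub>E UNIV \<and> rI y \<in> edges net \<rightarrow>\<^sub>E UNIV \<and>
     rS y \<in> edges net \<rightarrow>\<^sub>E UNIV \<and> rS' y \<in> Er net \<rightarrow>\<^sub>E UNIV \<and>
     rr y \<in> Er net \<rightarrow>\<^sub>E UNIV \<and> rA y \<in> Er net \<rightarrow>\<^sub>E UNIV}"

text \<open>The entrywise bounds on the complex vector \<open>diag_of (rV y n)\<close> include that its entries
  are real.\<close>

definition rbopf_feasible :: "network \<Rightarrow> rbopf_point set" where
  "rbopf_feasible net = {y \<in> rbopf_domain net.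
     svr_constraints net (rr y) (rA y) \<and>
     rinj y \<in> inj_set net \<and>
     (\<forall>(n, m)\<in>Et net. let Z = Zmat net (n, m); S = rS y (n, m) in
        rV y m = rV y n + Z ** rI y (n, m) ** ctrans Z - (S ** ctrans Z + Z ** ctrans S)) \<and>
     (\<forall>(n, m)\<in>Er net.
        rV y n = rA y (n, m) ** rV y m ** ctrans (rA y (n, m))) \<and>
     (\<forall>e\<in>Er net.
        diag_of (matrix_inv (rA y e) ** rS y e ** rA y e) = diag_of (rS' y e)) \<and>
     (\<forall>m\<in>nodes net. rs y m = rinj y m - diag_of (rV y m ** ctrans (Ymat net m))) \<and>
     (\<forall>m\<in>nodes net.
        rs y m =
          (\<Sum>k\<in>{k. (m, k) \<in> edges net}. diag_of (rS y (m, k)))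
        - (\<Sum>n\<in>{n. (n, m) \<in> edges net \<and> n \<in> svr_parents net m}. diag_of (rS' y (n, m)))
        - (\<Sum>n\<in>{n. (n, m) \<in> edges net \<and> n \<notin> svr_parents net m}.
             diag_of (rS y (n, m) - Zmat net (n, m) ** rI y (n, m)))) \<and>
     rV y 0 = outer (vref net) (vref net) \<and>
     (\<forall>n\<in>nodes net. \<forall>p.
        Im (diag_of (rV y n) $ p) = 0 \<and>
        (vmin net)\<^sup>2 \<le> Re (diag_of (rV y n) $ p) \<and>
        Re (diag_of (rV y n) $ p) \<le> (vmax net)\<^sup>2) \<and>
     (\<forall>(n, m)\<in>edges net.
        let M = block_mat (rV y n) (rS y (n, m)) (ctrans (rS y (n, m))) (rI y (n, m))
        in psd M \<and> rank M = 1)}"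

type_synonym rbopf_cost =
  "cvec \<Rightarrow> (nat \<Rightarrow> cvec) \<Rightarrow> (nat \<Rightarrow> cmat) \<Rightarrow> (edge \<Rightarrow> cmat) \<Rightarrow> real"

definition rbopf_objective :: "rbopf_cost \<Rightarrow> rbopf_point \<Rightarrow> real" where
  "rbopf_objective c y = c (rs y 0) (rinj y) (rV y) (rI y)"

subsection \<open>The correspondence between the two problems\<close>

definition outer_V :: "network \<Rightarrow> (nat \<Rightarrow> cvec) \<Rightarrow> nat \<Rightarrow> cmat" where
  "outer_V net v = (\<lambda>m\<in>nodes net. outer (v m) (v m))"

definition outer_I :: "network \<Rightarrow> (edge \<Rightarrow> cvec) \<Rightarrow> edge \<Rightarrow> cmat" where
  "outer_I net i = (\<lambda>e\<in>edges net. outer (i e) (i e))"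

definition lift_point :: "network \<Rightarrow> bopf_point \<Rightarrow> rbopf_point" where
  "lift_point net x = \<lparr>
     rs = bs x,
     rinj = binj x,
     rV = outer_V net (bv x),
     rI = outer_I net (bi x),
     rS = (\<lambda>(n, m)\<in>edges net. outer (bv x n) (bi x (n, m))),
     rS' = (\<lambda>(n, m)\<in>Er net. outer (bv x m) (bi' x (n, m))),
     rr = br x,
     rA = bA x\<rparr>"

text \<open>The cost of BOPF depends on the voltages and currents only through their outer products,
  and \<open>c'\<close> is that same cost written in the outer products.\<close>

definition same_cost :: "network \<Rightarrow> bopf_cost \<Rightarrow> rbopf_cost \<Rightarrow> bool" where
  "same_cost net c c' \<longleftrightarrow>
     (\<forall>s\<^sub>0. \<forall>\<ss> \<in> nodes net \<rightarrow>\<^sub>E UNIV. \<forall>v \<in> nodes net \<rightarrow>\<^sub>E UNIV. \<forall>i \<in> edges net \<rightarrow>\<^sub>E UNIV.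
        c s\<^sub>0 \<ss> v i = c' s\<^sub>0 \<ss> (outer_V net v) (outer_I net i))"

end

theory Submission
  imports Defs
begin

text \<open>The matrix variables of RBOPF are rank-one products of the vector variables of BOPF, so each
  constraint of RBOPF follows from the linear constraint of BOPF by multiplying out. The regulator
  constraint on \<open>S'\<close> also needs the gain matrices to be invertible, which holds because turns
  ratios close to \<open>1\<close> keep their determinants positive.\<close>

subsection \<open>Outer products\<close>

lemma outer_mult_left: "outer (M *v x) y = M ** outer x y"
  by (simp add: vec_eq_iff outer_def matrix_vector_mult_def matrix_matrix_mult_def
      sum_distrib_right mult.assoc)

lemma outer_mult_right: "outer x (M *v y) = outer x y ** ctrans M"
  by (simp add: vec_eq_iff outer_def ctrans_def matrix_vector_mult_def matrix_matrix_mult_def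
      sum_distrib_left mult_ac)

lemma outer_diff_left: "outer (x - y) z = outer x z - outer y z"
  by (simp add: vec_eq_iff outer_def left_diff_distrib)

lemma outer_diff_right: "outer x (y - z) = outer x y - outer x z"
  by (simp add: vec_eq_iff outer_def right_diff_distrib)

lemma ctrans_outer: "ctrans (outer x y) = outer y x"
  by (simp add: vec_eq_iff outer_def ctrans_def mult.commute)

text \<open>The quadratic form factors as a number times its own conjugate, so it is a squared
  modulus, hence real and nonnegative.\<close>

lemma psd_outer: "psd (outer x x)"
proof -
  have "(\<Sum>p\<in>UNIV. \<Sum>q\<in>UNIV. cnj (y $ p) * outer x x $ p $ q * y $ q)
      = complex_of_real ((cmod (\<Sum>p\<in>UNIV. cnj (y $ p) * x $ p))\<^sup>2)" for y
    by (simp only: complex_norm_square) (simp add: outer_def sum_product mult_ac)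
  then show ?thesis
    by (simp add: psd_def ctrans_outer del: of_real_power)
qed

text \<open>Row \<open>k\<close> is \<open>x $ k\<close> times one fixed vector, so a single row
  with \<open>x $ p\<close> nonzero spans the row space; a nonzero entry of \<open>y\<close> keeps
  that row from vanishing.\<close>

lemma rank_outer:
  assumes "x \<noteq> 0" "y \<noteq> 0"
  shows "rank (outer x y) = 1"
proof -
  obtain p where p: "x $ p \<noteq> 0"
    using assms(1) by (auto simp: vec_eq_iff)
  obtain q where q: "y $ q \<noteq> 0"
    using assms(2) by (auto simp: vec_eq_iff)
  let ?b = "row p (outer x y)"
  have "?b $ q \<noteq> 0"
    using p q by (simp add: row_def outer_def)
  then have b: "?b \<noteq> 0"
    by (metis zero_index)
  have "row k (outer x y) = (x $ k / x $ p) *s ?b" for k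
    using p by (simp add: vec_eq_iff row_def outer_def)
  then have "rows (outer x y) \<subseteq> vec.span {?b}"
    unfolding rows_def vec.span_singleton by blast
  then have "vec.dim (rows (outer x y)) = 1"
    using b by (intro vec.dim_unique[of "{?b}"]) (auto simp: rows_def)
  then show ?thesis
    by (simp add: row_rank_def_gen)
qed

definition append_vec :: "'a^'m \<Rightarrow> 'a^'l \<Rightarrow> 'a^('m + 'l)" where
  "append_vec x y = (\<chi> p. case p of Inl i \<Rightarrow> x $ i | Inr j \<Rightarrow> y $ j)"

text \<open>Reduces the semidefinite and rank conditions of RBOPF to the facts on a single outer
  product, with voltage and current stacked into one vector.\<close>

lemma block_mat_outer:
  "block_mat (outer x x) (outer x y) (outer y x) (outer y y)
    = outer (append_vec x y) (append_vec x y)"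
  by (simp add: vec_eq_iff block_mat_def outer_def append_vec_def split: sum.split)

lemma append_vec_nonzero:
  assumes "x \<noteq> 0"
  shows "append_vec x y \<noteq> 0"
proof -
  obtain p where "x $ p \<noteq> 0"
    using assms by (auto simp: vec_eq_iff)
  then have "append_vec x y $ Inl p \<noteq> 0"
    by (simp add: append_vec_def)
  then show ?thesis
    by (metis zero_index)
qed

subsection \<open>Inverses and gain matrices\<close>

text \<open>\<open>matrix_inv\<close> is defined by choice, so existence of a two-sided inverse must
  be supplied before its equations can be used.\<close>

lemma matrix_inv_inverse:
  assumes "invertible A"
  shows "A ** matrix_inv A = mat 1" and "matrix_inv A ** A = mat 1"
  using someI_ex[of "\<lambda>B. A ** B = mat 1 \<and> B ** A = mat 1"] assms
  by (auto simp: invertible_def matrix_inv_def)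

lemma matrix_diff_rdistrib:
  fixes A B :: "'a::ring_1^'n^'m"
  shows "(A - B) ** C = A ** C - B ** C"
  by (simp add: vec_eq_iff matrix_matrix_mult_def left_diff_distrib sum_subtractf)

lemma ctrans_mult: "ctrans (A ** B) = ctrans B ** ctrans A"
  by (simp add: vec_eq_iff ctrans_def matrix_matrix_mult_def mult.commute)

lemma ctrans_mat_1: "ctrans (mat 1) = mat 1"
  by (simp add: vec_eq_iff ctrans_def mat_def)

lemma ctrans_ctrans: "ctrans (ctrans A) = A"
  by (simp add: vec_eq_iff ctrans_def)

lemma invertible_ctrans:
  assumes "invertible A"
  shows "invertible (ctrans A)"
  using assms unfolding invertible_def by (metis ctrans_mult ctrans_mat_1)

text \<open>Moves the determinants of gain matrices to the reals, where the bounds on the turns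
  ratios apply.\<close>

lemma det_complex_mat:
  fixes M :: "real^'n::finite^'n"
  shows "det (complex_mat M) = complex_of_real (det M)"
  by (simp add: det_def complex_mat_def)

text \<open>The closed-delta case is the delicate one: its determinant is the product of the ratios
  plus the product of their deviations from 1. The first term is at least 0.729 and the second at
  most 0.001 in absolute value.\<close>

lemma invertible_gain_matrix:
  assumes "\<forall>p. 0.9 \<le> r $ p \<and> r $ p \<le> 1.1"
  shows "invertible (gain_matrix t r)"
proof -
  have r: "0.9 \<le> r $ 1" "r $ 1 \<le> 1.1" "0.9 \<le> r $ 2" "r $ 2 \<le> 1.1" "0.9 \<le> r $ 3" "r $ 3 \<le> 1.1"
    using assms by blast+
  have large: "0.9 * 0.9 * 0.9 \<le> r $ 1 * r $ 2 * r $ 3"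
    using r by (intro mult_mono) auto
  have "\<bar>1 - r $ p\<bar> \<le> 0.1" for p
    using assms[rule_format, of p] by linarith
  then have "\<bar>(1 - r $ 1) * (1 - r $ 2) * (1 - r $ 3)\<bar> \<le> 0.1 * 0.1 * 0.1"
    unfolding abs_mult by (intro mult_mono) auto
  with large have closed: "r $ 1 * r $ 2 * r $ 3 + (1 - r $ 1) * (1 - r $ 2) * (1 - r $ 3) \<noteq> 0"
    by linarith
  have "det (gain_matrix t r) \<noteq> 0"
  proof (cases t)
    case Wye
    have "det (gain_matrix t r) = complex_of_real (r $ 1 * r $ 2 * r $ 3)"
      by (simp only: Wye gain_matrix.simps det_complex_mat) (simp add: det_3 diag_mat_def)
    then show ?thesis
      using r by simp
  next
    case Closed_Delta
    have "det (gain_matrix t r) = complex_of_real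
        (r $ 1 * r $ 2 * r $ 3 + (1 - r $ 1) * (1 - r $ 2) * (1 - r $ 3))"
      by (simp only: Closed_Delta gain_matrix.simps det_complex_mat) (simp add: det_3)
    then show ?thesis
      using closed by (simp only: of_real_eq_0_iff not_False_eq_True)
  next
    case Open_Delta
    have "det (gain_matrix t r) = complex_of_real (r $ 1 * r $ 3)"
      by (simp only: Open_Delta gain_matrix.simps det_complex_mat) (simp add: det_3)
    then show ?thesis
      using r by simp
  qed
  then show ?thesis
    by (simp add: invertible_det_nz)
qed

text \<open>With voltages and currents in the roles of the vectors, this gives the \<open>S'\<close>
  constraint for whole matrices, of which RBOPF compares only the diagonals.\<close>

lemma matrix_inv_conjugation:
  assumes "invertible A" and "i = matrix_inv (ctrans A) *v j"
  shows "matrix_inv A ** outer (A *v x) i ** A = outer x j"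
proof -
  have "ctrans A *v i = j"
    using assms by (simp add: matrix_vector_mul_assoc matrix_inv_inverse invertible_ctrans)
  \<comment> \<open>Reading \<open>A\<close> as \<open>ctrans (ctrans A)\<close> moves it into the
    second argument of \<open>outer\<close>.\<close>
  then have "outer x i ** A = outer x j"
    by (metis outer_mult_right ctrans_ctrans)
  moreover have "matrix_inv A ** outer (A *v x) i = outer x i"
    using assms(1) by (simp add: outer_mult_left matrix_mul_assoc matrix_inv_inverse)
  ultimately show ?thesis
    by simp
qed

subsection \<open>Feasibility of the lifted point\<close>

lemma lift_point_feasible:
  assumes "valid_network net" and "x \<in> bopf_feasible net"
  shows "lift_point net x \<in> rbopf_feasible net"
proof -
  let ?y = "lift_point net x"
  have E: "n \<in> nodes net" "m \<in> nodes net" if "(n, m) \<in> edges net" for n m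
    using assms(1) that by (auto simp: valid_network_def)
  have Et: "(n, m) \<in> edges net" if "(n, m) \<in> Et net" for n m
    using that by (simp add: edges_def)
  have Er: "(n, m) \<in> edges net" if "(n, m) \<in> Er net" for n m
    using that by (simp add: edges_def)
  have zero: "0 \<in> nodes net"
    by (simp add: nodes_def)
  have V: "rV ?y n = outer (bv x n) (bv x n)" if "n \<in> nodes net" for n
    using that by (simp add: lift_point_def outer_V_def)
  have I: "rI ?y e = outer (bi x e) (bi x e)" if "e \<in> edges net" for e
    using that by (simp add: lift_point_def outer_I_def)
  have S: "rS ?y (n, m) = outer (bv x n) (bi x (n, m))" if "(n, m) \<in> edges net" for n m
    using that by (simp add: lift_point_def)
  have S': "rS' ?y (n, m) = outer (bv x m) (bi' x (n, m))" if "(n, m) \<in> Er net" for n m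
    using that by (simp add: lift_point_def)
  have same: "rs ?y = bs x" "rinj ?y = binj x" "rr ?y = br x" "rA ?y = bA x"
    by (simp_all add: lift_point_def)
  from assms(2)[unfolded bopf_feasible_def mem_Collect_eq Ball_def split_paired_All prod.case]
  have dom: "x \<in> bopf_domain net"
    and B1: "\<And>n m. (n, m) \<in> Et net \<Longrightarrow> bv x m = bv x n - Zmat net (n, m) *v bi x (n, m)"
    and B2: "\<And>n m. (n, m) \<in> Er net \<Longrightarrow> bv x n = bA x (n, m) *v bv x m"
      "\<And>n m. (n, m) \<in> Er net \<Longrightarrow> bi x (n, m) = matrix_inv (ctrans (bA x (n, m))) *v bi' x (n, m)"
    and B3: "svr_constraints net (br x) (bA x)"
    and B4: "\<And>m. m \<in> nodes net \<Longrightarrow>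
      bs x m = binj x m - diag_of (outer (bv x m) (bv x m) ** ctrans (Ymat net m))"
    and B5: "\<And>m. m \<in> nodes net \<Longrightarrow> bs x m =
          (\<Sum>k\<in>{k. (m, k) \<in> edges net}. diag_of (outer (bv x m) (bi x (m, k))))
        - (\<Sum>n\<in>{n. (n, m) \<in> edges net \<and> n \<in> svr_parents net m}.
             diag_of (outer (bv x m) (bi' x (n, m))))
        - (\<Sum>n\<in>{n. (n, m) \<in> edges net \<and> n \<notin> svr_parents net m}.
             diag_of (outer (bv x m) (bi x (n, m))))"
    and B6: "bv x 0 = vref net"
      "\<And>n p. n \<in> nodes net \<Longrightarrow> vmin net \<le> cmod (bv x n $ p)"
      "\<And>n p. n \<in> nodes net \<Longrightarrow> cmod (bv x n $ p) \<le> vmax net"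
      "binj x \<in> inj_set net"
    by blast+

  have "?y \<in> rbopf_domain net"
    using dom by (simp add: rbopf_domain_def bopf_domain_def lift_point_def outer_V_def outer_I_def)
  \<comment> \<open>Expanding the outer square of \<open>v_n - Z i\<close> gives exactly these four
    terms.\<close>
  moreover have "rV ?y m = rV ?y n + Zmat net (n, m) ** rI ?y (n, m) ** ctrans (Zmat net (n, m))
      - (rS ?y (n, m) ** ctrans (Zmat net (n, m)) + Zmat net (n, m) ** ctrans (rS ?y (n, m)))"
    if e: "(n, m) \<in> Et net" for n m
    using E[OF Et[OF e]] Et[OF e]
    by (simp add: V I S B1[OF e] ctrans_outer outer_diff_left outer_diff_right outer_mult_left
        outer_mult_right matrix_mul_assoc matrix_diff_rdistrib)
  moreover have "rV ?y n = rA ?y (n, m) ** rV ?y m ** ctrans (rA ?y (n, m))"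
    if e: "(n, m) \<in> Er net" for n m
    using E[OF Er[OF e]]
    by (simp add: V same B2(1)[OF e] outer_mult_left outer_mult_right matrix_mul_assoc)
  moreover have "diag_of (matrix_inv (rA ?y e) ** rS ?y e ** rA ?y e) = diag_of (rS' ?y e)"
    if e: "e \<in> Er net" for e
  proof -
    obtain n m where nm: "e = (n, m)"
      by force
    have "invertible (bA x (n, m))"
      using B3 e invertible_gain_matrix unfolding svr_constraints_def nm by metis
    \<comment> \<open>The flipped voltage equation turns \<open>A v_m\<close> back into
      \<open>v_n\<close>, the form in which \<open>rS\<close> is given.\<close>
    from matrix_inv_conjugation[OF this B2(2), of "bv x m"] e show ?thesis
      by (simp add: nm S S' Er same flip: B2(1))
  qed
  moreover have "rs ?y m = rinj ?y m - diag_of (rV ?y m ** ctrans (Ymat net m))"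
    if "m \<in> nodes net" for m
    using that by (simp add: same V B4)
  moreover have "rs ?y m =
          (\<Sum>k\<in>{k. (m, k) \<in> edges net}. diag_of (rS ?y (m, k)))
        - (\<Sum>n\<in>{n. (n, m) \<in> edges net \<and> n \<in> svr_parents net m}. diag_of (rS' ?y (n, m)))
        - (\<Sum>n\<in>{n. (n, m) \<in> edges net \<and> n \<notin> svr_parents net m}.
             diag_of (rS ?y (n, m) - Zmat net (n, m) ** rI ?y (n, m)))"
    if m: "m \<in> nodes net" for m
  proof -
    \<comment> \<open>Such an edge is not a regulator, so the line equation applies: the left side
      is the outer product of \<open>v_n - Z i\<close> with \<open>i\<close>, and
      \<open>v_n - Z i\<close> is \<open>v_m\<close>.\<close>
    have "rS ?y (n, m) - Zmat net (n, m) ** rI ?y (n, m) = outer (bv x m) (bi x (n, m))"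
      if "(n, m) \<in> edges net" "n \<notin> svr_parents net m" for n
    proof -
      have "(n, m) \<in> Et net"
        using that by (auto simp: edges_def svr_parents_def)
      then show ?thesis
        using that by (simp add: S I B1 outer_diff_left outer_mult_left)
    qed
    then show ?thesis
      unfolding same B5[OF m]
      by (intro arg_cong2[of _ _ _ _ "(-)"] sum.cong) (auto simp: S S' svr_parents_def)
  qed
  moreover have "rV ?y 0 = outer (vref net) (vref net)"
    using zero by (simp add: V B6)
  moreover have "Im (diag_of (rV ?y n) $ p) = 0 \<and>
        (vmin net)\<^sup>2 \<le> Re (diag_of (rV ?y n) $ p) \<and>
        Re (diag_of (rV ?y n) $ p) \<le> (vmax net)\<^sup>2" if n: "n \<in> nodes net" for n p
  proof -
    have "diag_of (rV ?y n) $ p = complex_of_real ((cmod (bv x n $ p))\<^sup>2)"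
      by (simp only: complex_norm_square) (simp add: V n diag_of_def outer_def)
    \<comment> \<open>Squaring the lower bound on the modulus preserves it because
      \<open>vmin\<close> is nonnegative.\<close>
    moreover have "0 < vmin net"
      using assms(1) by (simp add: valid_network_def)
    ultimately show ?thesis
      using B6(2,3)[OF n, of p] by (auto intro!: power_mono simp del: of_real_power)
  qed
  moreover have "psd (block_mat (rV ?y n) (rS ?y (n, m)) (ctrans (rS ?y (n, m))) (rI ?y (n, m)))
      \<and> rank (block_mat (rV ?y n) (rS ?y (n, m)) (ctrans (rS ?y (n, m))) (rI ?y (n, m))) = 1"
    if e: "(n, m) \<in> edges net" for n m
  proof -
    \<comment> \<open>The positive lower voltage bound keeps the stacked vector nonzero even when
      the current vanishes, so the rank is exactly 1.\<close>
    have "bv x n \<noteq> 0"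
      using B6(2)[OF E(1)[OF e]] assms(1) by (auto simp: valid_network_def)
    then show ?thesis
      using E[OF e] e
      by (simp add: V I S ctrans_outer block_mat_outer psd_outer rank_outer append_vec_nonzero)
  qed
  ultimately show ?thesis
    using B3 B6(4) unfolding rbopf_feasible_def by (auto simp: Let_def same)
qed

theorem proposition1:
  fixes net :: network
    and c :: bopf_cost
    and c' :: rbopf_cost
    and x :: bopf_point
  assumes "valid_network net"
    and "same_cost net c c'"
    and "x \<in> bopf_feasible net"
  shows "lift_point net x \<in> rbopf_feasible net
    \<and> rbopf_objective c' (lift_point net x) = bopf_objective c x"
proof
  show "lift_point net x \<in> rbopf_feasible net"
    using assms by (intro lift_point_feasible)
  show "rbopf_objective c' (lift_point net x) = bopf_objective c x"
    \<comment> \<open>Feasibility includes membership in the domain, which places the families in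
      the function spaces over which \<open>same_cost\<close> quantifies.\<close>
    using assms(2,3)
    by (simp add: same_cost_def bopf_feasible_def bopf_domain_def rbopf_objective_def
        bopf_objective_def lift_point_def)
qed

end
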